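(* Let $P$ be a positive odd integer and let $V_n = V_n(P,1)$. If $n\ge 1$ is an integer and $V_n = 5x^2$ for some integer $x$, then $n=1$.
   Context: For a positive integer $P$, the generalized Lucas sequence $V_n=V_n(P,1)$ is defined by $V_0=2$, $V_1=P$, and $V_{n+2}=PV_{n+1}+V_n$ for $n\ge 0$. *)

theory Defs
  imports Main
begin

(* lucas_V P n is V_n(P, 1), with the sign convention V_{n+2} = P V_{n+1} + Q V_n, Q = 1. *)
fun lucas_V :: "int \<Rightarrow> nat \<Rightarrow> int" where
  "lucas_V P 0 = 2"
| "lucas_V P (Suc 0) = P"
| "lucas_V P (Suc (Suc n)) = P * lucas_V P (Suc n) + lucas_V P n"

end

theory Submission
  imports Defs "HOL-Number_Theory.Number_Theory"
begin

text \<open>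
  Suppose \<open>V\<^sub>n = 5 x\<^sup>2\<close>. Modulo 5 the sequence meets 0 only if \<open>5\<close> divides \<open>P\<close>
  (\<open>five_dvd_lucas_V_imp\<close>), and then exactly at the odd indices, so \<open>n\<close> is odd and \<open>5 dvd P\<close>.
  What remains is a contradiction between two computations of the class of \<open>P\<close> modulo 8, one by
  quadratic residues and one by powers of 2.

  For even \<open>M\<close> the product formula \<open>lucas_V_add\<close> makes the sequence change sign modulo \<open>V\<^sub>M\<close>
  under a shift of the index by \<open>2 M\<close>. Take \<open>M = 2\<^sup>k\<close> with \<open>k \<ge> 1\<close> maximal such that \<open>2 M\<close>
  divides \<open>n - 1\<close> (if \<open>n mod 4 = 1\<close> and \<open>n > 1\<close>) or \<open>n + 1\<close> (if \<open>n mod 4 = 3\<close>). Then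
  \<open>5 x\<^sup>2\<close> is congruent to \<open>- P\<close>, respectively to \<open>P\<close>, modulo \<open>V\<^sub>M\<close>, so that \<open>- 5 P\<close>,
  respectively \<open>5 P\<close>, is a square modulo \<open>V\<^sub>M\<close>. Since \<open>V\<^sub>M\<close> is 3 modulo 4 and 2 modulo \<open>P\<^sup>2\<close>,
  reciprocity turns the Jacobi symbol of \<open>5 P\<close> modulo \<open>V\<^sub>M\<close> into the symbol of \<open>- 2\<close> modulo
  \<open>5 P\<close>, which depends only on \<open>P\<close> modulo 8. The outcome is that \<open>P\<close> is 1 or 3 modulo 8 if
  \<open>n mod 4 = 1\<close> and \<open>n > 1\<close>, and 5 or 7 modulo 8 if \<open>n mod 4 = 3\<close>.

  On the other hand, \<open>V\<close> has period 12 modulo 8, and even modulo 16 along the indices divisible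
  by 3. Comparing with the residues of \<open>5 x\<^sup>2\<close> shows exactly the opposite
  (\<open>five_square_mod_8\<close>): \<open>P\<close> is 5 or 7 modulo 8 if \<open>n mod 4 = 1\<close>, and 1 or 3 otherwise.
\<close>

section \<open>The Jacobi symbol\<close>

text \<open>
  Euler's criterion gives congruences only; for values as small as those of a Legendre symbol they
  are equalities.
\<close>

lemma eq_if_cong_and_small:
  assumes "q > 2" and "u \<in> {-1, 0, 1}" and "v \<in> {-1, 0, 1}" and "[u = v] (mod q)"
  shows "u = (v::int)"
proof -
  have "q dvd u - v" using assms(4) by (simp add: cong_iff_dvd_diff)
  moreover have "\<bar>u - v\<bar> \<le> 2" using assms(2,3) by auto
  ultimately show ?thesis using assms(1) dvd_imp_le_int[of "u - v" q] by fastforce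
qed

lemma legendre_range: "Legendre a q \<in> {-1, 0, 1}"
  by (simp add: Legendre_def)

lemma legendre_mult:
  assumes "prime q" and "q > 2"
  shows "Legendre (a * b) (int q) = Legendre a (int q) * Legendre b (int q)"
proof (rule eq_if_cong_and_small)
  show "int q > 2" using assms by simp
  show "Legendre (a * b) (int q) \<in> {-1, 0, 1}" by (rule legendre_range)
  show "Legendre a (int q) * Legendre b (int q) \<in> {-1, 0, 1}"
    using legendre_range[of a "int q"] legendre_range[of b "int q"] by auto
  have E: "[Legendre c (int q) = c ^ ((q - 1) div 2)] (mod int q)" for c
    using euler_criterion assms by blast
  show "[Legendre (a * b) (int q) = Legendre a (int q) * Legendre b (int q)] (mod int q)"
    using cong_trans[OF E[of "a * b"]] cong_sym[OF cong_mult[OF E[of a] E[of b]]]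
    by (simp add: power_mult_distrib)
qed

lemma legendre_cong: "[a = b] (mod q) \<Longrightarrow> Legendre a q = Legendre b q"
  unfolding Legendre_def QuadRes_def by (simp add: cong_def)

text \<open>
  The product over the prime factorization with multiplicity makes multiplicativity in \<open>n\<close>
  immediate; the remaining laws are lifted from primes to odd \<open>n\<close> along \<open>odd_prime_induct\<close>.
\<close>

definition jacobi :: "int \<Rightarrow> nat \<Rightarrow> int" where
  "jacobi a n = (\<Prod>q\<in>#prime_factorization n. Legendre a (int q))"

lemma jacobi_1_right [simp]: "jacobi a 1 = 1" "jacobi a (Suc 0) = 1"
  by (simp_all add: jacobi_def)

lemma jacobi_prime: "prime q \<Longrightarrow> jacobi a q = Legendre a (int q)"
  by (simp add: jacobi_def prime_factorization_prime)

lemma jacobi_mult_right: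
  "m > 0 \<Longrightarrow> n > 0 \<Longrightarrow> jacobi a (m * n) = jacobi a m * jacobi a n"
  by (simp add: jacobi_def prime_factorization_mult)

lemma jacobi_cong:
  assumes "[a = b] (mod int n)"
  shows "jacobi a n = jacobi b n"
proof -
  have "Legendre a (int q) = Legendre b (int q)" if "q \<in> prime_factors n" for q
    using that assms by (intro legendre_cong cong_dvd_modulus[OF assms]) auto
  then show ?thesis unfolding jacobi_def
    by (intro arg_cong[of _ _ prod_mset] image_mset_cong) simp
qed

lemma odd_prime_gt_2: "prime (q::nat) \<Longrightarrow> odd q \<Longrightarrow> q > 2"
  by (metis even_numeral order_le_less prime_ge_2_nat)

lemma odd_prime_induct [consumes 1, case_names one mult]:
  assumes "odd (n::nat)"
    and "Q 1"
    and "\<And>q m. prime q \<Longrightarrow> q > 2 \<Longrightarrow> odd q \<Longrightarrow> odd m \<Longrightarrow> Q m \<Longrightarrow> Q (q * m)"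
  shows "Q n"
  using assms(1)
proof (induction n rule: less_induct)
  case (less n)
  show ?case
  proof (cases "n = 1")
    case False
    then obtain q where q: "prime q" "q dvd n" using prime_factor_nat by blast
    then obtain m where m: "n = q * m" by blast
    then have "odd q" "odd m" using less.prems by auto
    moreover have "m < n" using m q(1) \<open>odd m\<close> prime_gt_1_nat[OF q(1)] by (simp add: odd_pos)
    ultimately show ?thesis using assms(3) less.IH q(1) m odd_prime_gt_2 by blast
  qed (use assms(2) in simp)
qed

lemma jacobi_mult_left:
  assumes "odd n"
  shows "jacobi (a * b) n = jacobi a n * jacobi b n"
  using assms
  by (induction rule: odd_prime_induct)
     (simp_all add: jacobi_mult_right odd_pos jacobi_prime prime_gt_0_nat legendre_mult)

lemma jacobi_1_left [simp]: assumes "odd n" shows "jacobi 1 n = 1"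
proof -
  have "Legendre 1 (int q) = 1" if "prime q" for q
    using that prime_gt_1_nat[OF that] unfolding Legendre_def QuadRes_def
    by (auto simp: cong_def intro!: exI[of _ 1])
  with assms show ?thesis
    by (induction rule: odd_prime_induct)
       (simp_all add: jacobi_mult_right odd_pos jacobi_prime prime_gt_0_nat)
qed

lemma jacobi_range: "odd n \<Longrightarrow> jacobi a n \<in> {-1, 0, 1}"
proof (induction rule: odd_prime_induct)
  case (mult q m)
  then show ?case using legendre_range[of a "int q"]
    by (auto simp add: jacobi_mult_right odd_pos jacobi_prime prime_gt_0_nat)
qed simp

lemma jacobi_square:
  assumes "odd n" and "jacobi (a ^ 2) n \<noteq> 0"
  shows "jacobi (a ^ 2) n = 1"
  using assms jacobi_range[of n a] by (auto simp: power2_eq_square jacobi_mult_left)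

text \<open>
  On odd \<open>n\<close> this is the nontrivial Dirichlet character modulo 4, that is \<open>(-1) ^ ((n - 1) div 2)\<close>.
\<close>

definition chi4 :: "nat \<Rightarrow> int" where
  "chi4 n = (if n mod 4 = 1 then 1 else -1)"

text \<open>
  The sign \<open>(-1) ^ ((m - 1) div 2 * ((n - 1) div 2))\<close> of the reciprocity law, in terms of residues
  so that its multiplicativity is a finite check.
\<close>

definition recsign :: "nat \<Rightarrow> nat \<Rightarrow> int" where
  "recsign m n = (if m mod 4 = 3 \<and> n mod 4 = 3 then -1 else 1)"

lemma odd_mod_4: "odd (n::nat) \<Longrightarrow> n mod 4 = 1 \<or> n mod 4 = 3"
  by presburger

lemma mult_mod_4:
  assumes "odd (m::nat)" "odd n"
  shows "(m * n) mod 4 = (if m mod 4 = n mod 4 then 1 else 3)"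
proof -
  have "(m * n) mod 4 = ((m mod 4) * (n mod 4)) mod 4" by (simp add: mod_mult_eq)
  then show ?thesis using odd_mod_4[OF assms(1)] odd_mod_4[OF assms(2)] by auto
qed

lemma chi4_mult: "odd m \<Longrightarrow> odd n \<Longrightarrow> chi4 (m * n) = chi4 m * chi4 n"
  unfolding chi4_def using odd_mod_4[of m] odd_mod_4[of n] by (auto simp: mult_mod_4)

lemma recsign_sym: "recsign m n = recsign n m"
  by (auto simp: recsign_def)

lemma recsign_mult: "odd m \<Longrightarrow> odd n \<Longrightarrow> recsign k (m * n) = recsign k m * recsign k n"
  unfolding recsign_def using odd_mod_4[of m] odd_mod_4[of n] by (auto simp: mult_mod_4)

lemma even_half_iff: "odd n \<Longrightarrow> even ((n - 1) div 2) \<longleftrightarrow> n mod 4 = (1::nat)"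
  by presburger

lemma jacobi_minus_1:
  assumes "odd n"
  shows "jacobi (-1) n = chi4 n"
  using assms
proof (induction rule: odd_prime_induct)
  case (mult q m)
  have "Legendre (-1) (int q) = chi4 q"
  proof (rule eq_if_cong_and_small)
    show "[Legendre (-1) (int q) = chi4 q] (mod int q)"
      using euler_criterion[OF mult(1,2), of "-1"] even_half_iff[OF mult(3)]
      by (auto simp: chi4_def uminus_power_if)
  qed (use mult legendre_range in \<open>auto simp: chi4_def Legendre_def\<close>)
  with mult show ?case
    by (simp add: jacobi_mult_right odd_pos jacobi_prime prime_gt_0_nat chi4_mult)
qed (simp add: chi4_def)

lemma legendre_reciprocity:
  assumes "prime p" "p > 2" "prime q" "q > 2"
  shows "Legendre (int p) (int q) = recsign p q * Legendre (int q) (int p)"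
proof (cases "p = q")
  case True
  then show ?thesis by (simp add: Legendre_def cong_0_iff)
next
  case False
  have odd: "odd p" "odd q" using assms prime_odd_nat by blast+
  have "Legendre (int p) (int q) * Legendre (int q) (int p) = recsign p q"
    using Quadratic_Reciprocity[OF assms False] even_half_iff[OF odd(1)] even_half_iff[OF odd(2)]
      odd_mod_4[OF odd(1)] odd_mod_4[OF odd(2)]
    by (auto simp: recsign_def uminus_power_if)
  then show ?thesis
    using legendre_range[of "int p" "int q"] legendre_range[of "int q" "int p"]
    by (auto simp: recsign_def split: if_splits)
qed

text \<open>
  Both sides are multiplicative in \<open>m\<close> and in \<open>n\<close>, so the law for two primes extends by one
  induction in each argument. Arguments with a common factor are covered because both symbols
  then vanish.
\<close>

lemma jacobi_reciprocity:
  assumes "odd m" and "odd n"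
  shows "jacobi (int m) n = recsign m n * jacobi (int n) m"
  using assms(1)
proof (induction rule: odd_prime_induct)
  case one
  then show ?case using assms(2) by (simp add: recsign_def)
next
  case (mult p m)
  have "jacobi (int p) n = recsign p n * jacobi (int n) p"
    using assms(2)
  proof (induction rule: odd_prime_induct)
    case one
    then show ?case using mult(3) by (simp add: recsign_def)
  next
    case (mult q k)
    with \<open>prime p\<close> \<open>p > 2\<close> \<open>odd p\<close> show ?case
      using legendre_reciprocity[of p q] legendre_mult[of p "int q" "int k"]
      by (simp add: jacobi_mult_right jacobi_mult_left odd_pos jacobi_prime prime_gt_0_nat
          recsign_mult)
  qed
  with mult assms(2) show ?case
    by (simp add: jacobi_mult_right jacobi_mult_left odd_pos prime_gt_0_nat
        recsign_mult recsign_sym[of _ n])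
qed

text \<open>
  Since \<open>-2\<close> is \<open>n - 2\<close> modulo \<open>n\<close> and one of \<open>n\<close>, \<open>n - 2\<close> is 1 modulo 4, reciprocity gives
  \<open>(-2/n) = (n/(n-2)) = (2/(n-2)) = (-1/(n-2)) (-2/(n-2))\<close>. This recursion, started at
  \<open>n = 1\<close>, determines the symbol.
\<close>

lemma jacobi_minus_2:
  assumes "odd n"
  shows "jacobi (-2) n = (if n mod 8 \<in> {1, 3} then 1 else -1)"
  using assms
proof (induction n rule: less_induct)
  case (less n)
  show ?case
  proof (cases "n = 1")
    case False
    define k where "k = n - 2"
    have n: "n = k + 2" "odd k" using less.prems False unfolding k_def
      by (auto intro: Suc_lessI) presburger+
    have "jacobi (-2) n = jacobi (int k) n"
      by (rule jacobi_cong) (use n in \<open>auto simp: cong_iff_dvd_diff intro: dvdI[of _ _ "-1"]\<close>)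
    also have "\<dots> = jacobi (int n) k"
      using jacobi_reciprocity[of k n] n by (simp add: recsign_def) presburger
    also have "\<dots> = jacobi (-1 * -2) k"
      by (rule jacobi_cong) (simp add: n cong_iff_dvd_diff)
    also have "\<dots> = chi4 k * jacobi (-2) k"
      using n jacobi_mult_left jacobi_minus_1 by metis
    also have "jacobi (-2) k = (if k mod 8 \<in> {1, 3} then 1 else -1)"
      using less.IH n by simp
    also have "chi4 k * \<dots> = (if n mod 8 \<in> {1, 3} then 1 else -1)"
    proof -
      have "k mod 8 = 1 \<or> k mod 8 = 3 \<or> k mod 8 = 5 \<or> k mod 8 = 7" using n(2) by presburger
      moreover have "k mod 4 = k mod 8 mod 4" by (simp add: mod_mod_cancel)
      moreover have "n mod 8 = (k mod 8 + 2) mod 8" by (simp add: n mod_simps)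
      ultimately show ?thesis by (auto simp: chi4_def)
    qed
    finally show ?thesis .
  qed simp
qed

section \<open>The product formula and congruences in the parameter\<close>

lemma lucas_V_pos: "P > 0 \<Longrightarrow> lucas_V P n > 0"
  by (induction n rule: induct_nat_012) (simp_all add: add_pos_pos)

text \<open>
  With \<open>\<alpha>\<close>, \<open>\<beta>\<close> the roots of \<open>t\<^sup>2 - P t - 1\<close> one has \<open>V\<^sub>i = \<alpha>\<^sup>i + \<beta>\<^sup>i\<close> and
  \<open>\<alpha> \<beta> = -1\<close>; the formula is the expansion of \<open>V\<^sub>d\<^sub>+\<^sub>j V\<^sub>j\<close>. The index \<open>d\<close> plays the part
  of a difference \<open>i - j\<close>, which avoids truncated subtraction.
\<close>

lemma lucas_V_add:
  "lucas_V P (d + 2 * j) = lucas_V P (d + j) * lucas_V P j - (-1) ^ j * lucas_V P d"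
proof (induction j arbitrary: d rule: induct_nat_012)
  case (ge2 j)
  have "lucas_V P (d + 2 * Suc (Suc j))
      = P * lucas_V P (Suc d + 2 * Suc j) + lucas_V P (Suc (Suc d) + 2 * j)"
    by simp
  also have "\<dots> = P * (lucas_V P (Suc d + Suc j) * lucas_V P (Suc j)
        - (-1) ^ Suc j * lucas_V P (Suc d))
      + (lucas_V P (Suc (Suc d) + j) * lucas_V P j - (-1) ^ j * lucas_V P (Suc (Suc d)))"
    by (simp only: ge2.IH)
  also have "\<dots> = lucas_V P (d + Suc (Suc j)) * lucas_V P (Suc (Suc j))
      - (-1) ^ Suc (Suc j) * lucas_V P d"
    by (simp add: algebra_simps)
  finally show ?case .
qed simp_all

lemma lucas_V_cong_parameter: "[P = P'] (mod m) \<Longrightarrow> [lucas_V P n = lucas_V P' n] (mod m)"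
  by (induction n rule: induct_nat_012) (auto intro: cong_add cong_mult)

section \<open>Divisibility by 5\<close>

text \<open>
  The left-hand side is the norm form of \<open>t\<^sup>2 - P t - 1\<close>, which changes sign at each step
  because the roots have product \<open>-1\<close>. It yields information on a term modulo a divisor of the
  preceding one.
\<close>

lemma lucas_V_norm:
  "lucas_V P (Suc n) ^ 2 - P * lucas_V P (Suc n) * lucas_V P n - lucas_V P n ^ 2
    = - ((-1) ^ n * (P ^ 2 + 4))"
proof (induction n)
  case (Suc n)
  have "lucas_V P (Suc (Suc n)) ^ 2 - P * lucas_V P (Suc (Suc n)) * lucas_V P (Suc n)
      - lucas_V P (Suc n) ^ 2
    = - (lucas_V P (Suc n) ^ 2 - P * lucas_V P (Suc n) * lucas_V P n - lucas_V P n ^ 2)"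
    by (simp add: power2_eq_square algebra_simps)
  then show ?case by (simp only: Suc.IH) simp
qed (simp add: power2_eq_square)

lemma not_five_dvd_consecutive: "\<not> (5 dvd lucas_V P n \<and> 5 dvd lucas_V P (Suc n))"
  by (induction n) (auto simp: dvd_add_right_iff)

text \<open>
  If \<open>5\<close> divides \<open>V\<^sub>n\<close>, then \<open>V\<^sub>n\<^sub>+\<^sub>1\<^sup>2\<close> is \<open>P\<^sup>2 + 4\<close> up to sign modulo 5. If \<open>P\<close> is not divisible by 5,
  this is 0 or a nonresidue (\<open>3\<close> or \<open>-3\<close>). The second is impossible, and the first makes two
  consecutive terms divisible by 5.
\<close>

lemma five_dvd_lucas_V_imp:
  assumes "5 dvd lucas_V P n"
  shows "5 dvd P"
proof (rule ccontr)
  assume P: "\<not> 5 dvd P"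
  define v where "v = lucas_V P (Suc n)"
  obtain u where u: "lucas_V P n = 5 * u" using assms by blast
  have "v ^ 2 + (-1) ^ n * (P ^ 2 + 4) = 5 * (P * v * u + 5 * u ^ 2)"
    using lucas_V_norm[of P n] unfolding u v_def[symmetric] by (simp add: power2_eq_square algebra_simps)
  then have norm: "5 dvd v ^ 2 + (-1) ^ n * (P ^ 2 + 4)" by simp
  have "\<not> 5 dvd v" using not_five_dvd_consecutive assms by (auto simp: v_def)
  have squares: "y ^ 2 mod 5 \<in> {1, 4}" if "\<not> 5 dvd y" for y :: int
  proof -
    have "y mod 5 \<in> {1, 2, 3, 4}" using that unfolding insert_iff empty_iff by presburger
    moreover have "y ^ 2 mod 5 = (y mod 5) ^ 2 mod 5" by (simp add: power_mod)
    ultimately show ?thesis by auto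
  qed
  define a b where "a = v ^ 2" and "b = P ^ 2"
  have "a mod 5 \<in> {1, 4}" "b mod 5 \<in> {1, 4}"
    using squares[OF P] squares[OF \<open>\<not> 5 dvd v\<close>] by (simp_all add: a_def b_def)
  moreover have "5 dvd a + (b + 4) \<or> 5 dvd a - (b + 4)"
    using norm unfolding a_def b_def by (cases "even n") (simp_all add: algebra_simps)
  ultimately show False unfolding insert_iff empty_iff by presburger
qed

text \<open>
  Modulo 5 the sequence is the one with parameter 0, namely 2, 0, 2, 0, and so on.
\<close>

lemma odd_index_if_five_dvd:
  assumes "5 dvd P" and "5 dvd lucas_V P n"
  shows "odd n"
proof -
  have "lucas_V 0 n = (if even n then 2 else 0)" by (induction n rule: induct_nat_012) auto
  moreover have "[lucas_V P n = lucas_V 0 n] (mod 5)"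
    by (rule lucas_V_cong_parameter) (use assms in \<open>simp add: cong_0_iff\<close>)
  ultimately show ?thesis using assms(2) by (auto simp: cong_dvd_iff split: if_splits)
qed

section \<open>Quadratic residues modulo terms whose index is a power of 2\<close>

lemma lucas_V_reflect:
  assumes "even M"
  shows "[lucas_V P (d + 2 * M) = - lucas_V P d] (mod lucas_V P M)"
  using assms by (simp add: lucas_V_add cong_iff_dvd_diff)

lemma lucas_V_period:
  assumes "even M"
  shows "[lucas_V P (d + 4 * M * l) = lucas_V P d] (mod lucas_V P M)"
proof (induction l)
  case (Suc l)
  have "[lucas_V P (d + 4 * M * l + 2 * M + 2 * M) = - lucas_V P (d + 4 * M * l + 2 * M)]
      (mod lucas_V P M)"
    by (rule lucas_V_reflect[OF assms])
  also have "[- lucas_V P (d + 4 * M * l + 2 * M) = - (- lucas_V P (d + 4 * M * l))]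
      (mod lucas_V P M)"
    by (subst cong_minus_minus_iff) (rule lucas_V_reflect[OF assms])
  finally show ?case using Suc.IH cong_trans by (fastforce simp: algebra_simps)
qed simp

lemma pow2_times_odd:
  assumes "(N::nat) > 0"
  obtains k l where "N = 2 ^ k * (2 * l + 1)"
  using assms
proof (induction N arbitrary: thesis rule: less_induct)
  case (less N)
  show ?case
  proof (cases "even N")
    case True
    then obtain N' where N': "N = 2 * N'" by blast
    with less.prems(2) obtain k l where "N' = 2 ^ k * (2 * l + 1)"
      using less.IH[of N'] by auto
    then show ?thesis using N' less.prems(1)[of "Suc k" l] by simp
  next
    case False
    then show ?thesis using less.prems(1)[of 0] by (metis mult_1 oddE power_0)
  qed
qed

text \<open>
  The modulus is chosen so that \<open>n - 1\<close> is an odd multiple of twice its index: an odd number of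
  sign changes then leads from \<open>V\<^sub>1 = P\<close> to \<open>V\<^sub>n\<close>.
\<close>

lemma lucas_V_cong_1_mod_4:
  assumes "n mod 4 = 1" and "n > 1"
  obtains k where "[lucas_V P n = - P] (mod lucas_V P (2 ^ Suc k))"
proof -
  have "n div 4 > 0" using assms by presburger
  then obtain k l where kl: "n div 4 = 2 ^ k * (2 * l + 1)" by (rule pow2_times_odd)
  have "n = 4 * (n div 4) + 1" using assms(1) by presburger
  then have n: "n = (1 + 2 * 2 ^ Suc k) + 4 * 2 ^ Suc k * l"
    unfolding kl by (simp add: algebra_simps)
  have "[lucas_V P n = lucas_V P (1 + 2 * 2 ^ Suc k)] (mod lucas_V P (2 ^ Suc k))"
    unfolding n by (rule lucas_V_period) simp
  also have "[lucas_V P (1 + 2 * 2 ^ Suc k) = - lucas_V P 1] (mod lucas_V P (2 ^ Suc k))"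
    by (rule lucas_V_reflect) simp
  finally show ?thesis using that by simp
qed

text \<open>
  Here \<open>n + 1\<close> is an odd multiple of \<open>2 M\<close>. In place of the term \<open>V\<^sub>-\<^sub>1 = - P\<close> the descent ends
  at its reflection \<open>V\<^sub>2\<^sub>M\<^sub>-\<^sub>1\<close>, which is congruent to \<open>P\<close>.
\<close>

lemma lucas_V_cong_3_mod_4:
  assumes "n mod 4 = 3"
  obtains k where "[lucas_V P n = P] (mod lucas_V P (2 ^ Suc k))"
proof -
  obtain k l where kl: "n div 4 + 1 = 2 ^ k * (2 * l + 1)"
    by (rule pow2_times_odd[of "n div 4 + 1"]) simp
  define M :: nat where "M = 2 ^ Suc k"
  have M: "even M" "M \<ge> 1" by (simp_all add: M_def)
  have "n + 1 = 4 * (n div 4 + 1)" using assms by presburger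
  then have "n + 1 = 2 * M + 4 * M * l"
    unfolding kl M_def by (simp add: algebra_simps)
  then have n: "n = (1 + 2 * (M - 1)) + 4 * M * l" using M(2) by linarith
  have "[lucas_V P n = lucas_V P (1 + 2 * (M - 1))] (mod lucas_V P M)"
    unfolding n by (rule lucas_V_period[OF M(1)])
  also have "lucas_V P (1 + 2 * (M - 1)) = lucas_V P M * lucas_V P (M - 1) + P"
    using M by (simp only: lucas_V_add) simp
  also have "[\<dots> = P] (mod lucas_V P M)" by (simp add: cong_iff_dvd_diff)
  finally show ?thesis using that by (simp add: M_def)
qed

text \<open>
  Doubling the index \<open>M\<close> for even \<open>M\<close> replaces \<open>v\<close> by \<open>v\<^sup>2 - 2\<close>, a map that fixes 3 modulo 4
  and fixes 2.
\<close>

lemma lucas_V_pow2: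
  assumes "odd P"
  shows "lucas_V P (2 ^ Suc k) mod 4 = 3" and "P ^ 2 dvd lucas_V P (2 ^ Suc k) - 2"
proof -
  have "lucas_V P (2 ^ Suc k) mod 4 = 3 \<and> P ^ 2 dvd lucas_V P (2 ^ Suc k) - 2"
  proof (induction k)
    case 0
    obtain c where "P = 2 * c + 1" using assms by (rule oddE)
    then have "P ^ 2 + 2 = 4 * (c ^ 2 + c) + 3" by (simp add: power2_eq_square algebra_simps)
    then have "(P ^ 2 + 2) mod 4 = 3" by presburger
    moreover have "lucas_V P (2 ^ Suc 0) = P ^ 2 + 2"
      by (simp add: numeral_2_eq_2)
    ultimately show ?case by simp
  next
    case (Suc k)
    define v where "v = lucas_V P (2 ^ Suc k)"
    have double: "lucas_V P (2 ^ Suc (Suc k)) = v ^ 2 - 2"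
      using lucas_V_add[of P 0 "2 ^ Suc k"] by (simp add: v_def power2_eq_square)
    have v: "v mod 4 = 3" "P ^ 2 dvd v - 2" using Suc.IH by (simp_all add: v_def)
    have "(v ^ 2 - 2) mod 4 = 3"
    proof -
      have "v = 4 * (v div 4) + 3" using v(1) by presburger
      then obtain c where "v = 4 * c + 3" by blast
      then have "v ^ 2 - 2 = 4 * (4 * c ^ 2 + 6 * c + 1) + 3" by (simp add: power2_eq_square algebra_simps)
      then show ?thesis by presburger
    qed
    moreover have "v ^ 2 - 2 - 2 = (v - 2) * (v + 2)" by (simp add: power2_eq_square algebra_simps)
    ultimately show ?case unfolding double using v by simp
  qed
  then show "lucas_V P (2 ^ Suc k) mod 4 = 3" and "P ^ 2 dvd lucas_V P (2 ^ Suc k) - 2"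
    by blast+
qed

text \<open>
  As \<open>5 P\<close> divides \<open>P\<^sup>2\<close>, the term \<open>N\<close> is 2 modulo \<open>5 P\<close>. As \<open>N\<close> is 3 modulo 4, the reciprocity
  sign is the symbol of \<open>-1\<close> modulo \<open>5 P\<close>. Together they give the symbol of \<open>-2\<close>.
\<close>

lemma jacobi_lucas_V_pow2:
  assumes "P > 0" and "odd P" and "5 dvd P"
  shows "jacobi (5 * P) (nat (lucas_V P (2 ^ Suc k))) = jacobi (-2) (nat (5 * P))"
    and "jacobi (-1) (nat (lucas_V P (2 ^ Suc k))) = -1"
    and "odd (nat (lucas_V P (2 ^ Suc k)))"
proof -
  define m where "m = nat (5 * P)"
  define N where "N = nat (lucas_V P (2 ^ Suc k))"
  have m: "int m = 5 * P" "odd m" using assms by (simp_all add: m_def even_nat_iff)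
  have N: "int N = lucas_V P (2 ^ Suc k)" using lucas_V_pos[OF assms(1)] by (simp add: N_def order_less_imp_le)
  then have N4: "N mod 4 = 3" using lucas_V_pow2(1)[OF assms(2), of k] by presburger
  then have "odd N" by presburger
  have "5 * P dvd P ^ 2" using assms(3) by (simp add: power2_eq_square)
  then have N2: "[int N = -1 * -2] (mod int m)"
    using lucas_V_pow2(2)[OF assms(2), of k] unfolding m N
    by (auto simp: cong_iff_dvd_diff intro: dvd_trans)
  have "jacobi (int m) N = recsign m N * jacobi (int N) m"
    by (rule jacobi_reciprocity) fact+
  also have "jacobi (int N) m = chi4 m * jacobi (-2) m"
    using jacobi_cong[OF N2] jacobi_mult_left[OF m(2)] jacobi_minus_1[OF m(2)] by metis
  also have "recsign m N * (chi4 m * jacobi (-2) m) = jacobi (-2) m"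
    using N4 odd_mod_4[OF m(2)] by (auto simp: recsign_def chi4_def)
  finally show "jacobi (5 * P) N = jacobi (-2) m" by (simp add: m)
  show "odd N" by fact
  show "jacobi (-1) N = -1" using jacobi_minus_1[OF \<open>odd N\<close>] N4 by (simp add: chi4_def)
qed

lemma jacobi_minus_2_five_times:
  assumes "P > 0" and "odd (P::int)"
  shows "jacobi (-2) (nat (5 * P)) = (if P mod 8 \<in> {5, 7} then 1 else -1)"
proof -
  have "odd (nat (5 * P))" using assms by (simp add: even_nat_iff)
  moreover have "nat (5 * P) mod 8 \<in> {1, 3} \<longleftrightarrow> P mod 8 \<in> {5, 7}"
  proof -
    define m where "m = nat (5 * P)"
    have "int m = 5 * P" using assms by (simp add: m_def)
    then have "int (m mod 8) = (5 * (P mod 8)) mod 8" by (simp add: zmod_int mod_simps)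
    moreover have "P mod 8 = 1 \<or> P mod 8 = 3 \<or> P mod 8 = 5 \<or> P mod 8 = 7"
      using assms(2) by presburger
    ultimately show ?thesis unfolding m_def[symmetric] by (elim disjE) simp_all
  qed
  ultimately show ?thesis by (simp add: jacobi_minus_2)
qed

text \<open>
  Multiplying \<open>5 x\<^sup>2 = - P\<close> modulo \<open>N\<close> by 5 exhibits \<open>- 5 P\<close> as a square. Its symbol is
  nonzero, being a sign times a symbol of \<open>-2\<close>, so it is 1. Hence the symbol of \<open>5 P\<close> is \<open>-1\<close>.
\<close>

lemma five_square_1_mod_4:
  assumes "P > 0" and "odd P" and "5 dvd P" and "lucas_V P n = 5 * x ^ 2"
    and "n mod 4 = 1" and "n > 1"
  shows "P mod 8 \<notin> {5, 7}"
proof -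
  obtain k where k: "[lucas_V P n = - P] (mod lucas_V P (2 ^ Suc k))"
    using assms(5,6) by (rule lucas_V_cong_1_mod_4)
  define N where "N = nat (lucas_V P (2 ^ Suc k))"
  note J = jacobi_lucas_V_pow2[OF assms(1-3), of k, folded N_def]
  have N: "int N = lucas_V P (2 ^ Suc k)"
    using lucas_V_pos[OF assms(1)] by (simp add: N_def order_less_imp_le)
  have "[5 * lucas_V P n = 5 * - P] (mod int N)" unfolding N by (intro cong_mult cong_refl k)
  then have "[(5 * x) ^ 2 = -1 * (5 * P)] (mod int N)" by (simp add: assms(4) power_mult_distrib)
  then have "jacobi ((5 * x) ^ 2) N = - jacobi (-2) (nat (5 * P))"
    using jacobi_cong jacobi_mult_left[OF J(3)] J(1,2) by (metis mult_minus1)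
  then show ?thesis
    using jacobi_square[OF J(3), of "5 * x"]
      jacobi_minus_2_five_times[OF assms(1,2)]
    by (auto split: if_splits)
qed

text \<open>
  Now \<open>5 P\<close> itself is a square modulo \<open>N\<close>, hence the opposite conclusion.
\<close>

lemma five_square_3_mod_4:
  assumes "P > 0" and "odd P" and "5 dvd P" and "lucas_V P n = 5 * x ^ 2"
    and "n mod 4 = 3"
  shows "P mod 8 \<in> {5, 7}"
proof -
  obtain k where k: "[lucas_V P n = P] (mod lucas_V P (2 ^ Suc k))"
    using assms(5) by (rule lucas_V_cong_3_mod_4)
  define N where "N = nat (lucas_V P (2 ^ Suc k))"
  note J = jacobi_lucas_V_pow2[OF assms(1-3), of k, folded N_def]
  have N: "int N = lucas_V P (2 ^ Suc k)"
    using lucas_V_pos[OF assms(1)] by (simp add: N_def order_less_imp_le)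
  have "[5 * lucas_V P n = 5 * P] (mod int N)" unfolding N by (intro cong_mult cong_refl k)
  then have "[(5 * x) ^ 2 = 5 * P] (mod int N)" by (simp add: assms(4) power_mult_distrib)
  then have "jacobi ((5 * x) ^ 2) N = jacobi (-2) (nat (5 * P))"
    using jacobi_cong J(1) by metis
  then show ?thesis
    using jacobi_square[OF J(3), of "5 * x"]
      jacobi_minus_2_five_times[OF assms(1,2)]
    by (auto split: if_splits)
qed

section \<open>Residues modulo powers of 2\<close>

text \<open>
  Three applications of \<open>V\<^sub>i\<^sub>+\<^sub>6 = V\<^sub>i + V\<^sub>3 V\<^sub>i\<^sub>+\<^sub>3\<close>. As \<open>V\<^sub>3\<close> is divisible by 4 for odd \<open>P\<close>, the
  increment is divisible by 8.
\<close>

lemma lucas_V_add_12: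
  "lucas_V P (n + 12) = lucas_V P n
     + lucas_V P 3 * (2 * lucas_V P (n + 3) + lucas_V P 3 * lucas_V P (n + 6))"
  using lucas_V_add[of P n 3] lucas_V_add[of P "n + 3" 3] lucas_V_add[of P "n + 6" 3]
  by (simp add: algebra_simps)

lemma four_dvd_lucas_V_3: "odd P \<Longrightarrow> 4 dvd lucas_V P 3"
proof -
  assume "odd P"
  then obtain c where c: "P = 2 * c + 1" by (rule oddE)
  have "lucas_V P 3 = P * (P ^ 2 + 3)"
    by (simp add: eval_nat_numeral algebra_simps)
  also have "\<dots> = 4 * (P * (c ^ 2 + c + 1))" unfolding c by (simp add: power2_eq_square algebra_simps)
  finally show ?thesis by simp
qed

lemma lucas_V_mod_8:
  assumes "odd P"
  shows "[lucas_V P (r + 12 * q) = lucas_V P r] (mod 8)"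
proof (induction q)
  case (Suc q)
  obtain w where w: "lucas_V P 3 = 4 * w" using four_dvd_lucas_V_3[OF assms] by blast
  have "[lucas_V P (r + 12 * q + 12) = lucas_V P (r + 12 * q)] (mod 8)"
    unfolding lucas_V_add_12[of P "r + 12 * q"] w by (simp add: cong_iff_dvd_diff mult.assoc distrib_left)
  then show ?case using Suc.IH cong_trans by (fastforce simp: algebra_simps)
qed simp

text \<open>
  The factor 2 gained over modulus 8 comes from \<open>2 V\<^sub>3 V\<^sub>r\<^sub>+\<^sub>3\<close> in \<open>lucas_V_add_12\<close>. Evenness of
  \<open>V\<^sub>r\<^sub>+\<^sub>3\<close> is inherited by the later indices through the period modulo 8.
\<close>

lemma lucas_V_mod_16:
  assumes "odd P" and "even (lucas_V P (r + 3))"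
  shows "[lucas_V P (r + 12 * q) = lucas_V P r] (mod 16)"
proof (induction q)
  case (Suc q)
  obtain w where w: "lucas_V P 3 = 4 * w" using four_dvd_lucas_V_3[OF assms(1)] by blast
  have "[lucas_V P (r + 3 + 12 * q) = lucas_V P (r + 3)] (mod 2)"
    using lucas_V_mod_8[OF assms(1)] by (rule cong_dvd_modulus) simp
  then have "even (lucas_V P (r + 12 * q + 3))"
    using assms(2) by (simp add: cong_dvd_iff algebra_simps)
  then obtain u where u: "lucas_V P (r + 12 * q + 3) = 2 * u" by blast
  have "[lucas_V P (r + 12 * q + 12) = lucas_V P (r + 12 * q)] (mod 16)"
    unfolding lucas_V_add_12[of P "r + 12 * q"] w u by (simp add: cong_iff_dvd_diff algebra_simps)
  then show ?case using Suc.IH cong_trans by (fastforce simp: algebra_simps)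
qed simp

text \<open>
  Values for the residue check below, arranged so that evaluating them at a number does not unfold
  the exponential recursion of \<open>lucas_V\<close>.
\<close>

lemma lucas_V_odd_index:
  "lucas_V P 3 = P * (P ^ 2 + 3)"
  "lucas_V P 5 = lucas_V P 3 * (P ^ 2 + 2) - P"
  "lucas_V P 7 = ((P ^ 2 + 2) ^ 2 - 2) * lucas_V P 3 + P"
  "lucas_V P 9 = lucas_V P 3 * (lucas_V P 3 ^ 2 + 3)"
  "lucas_V P 11 = (((P ^ 2 + 2) ^ 2 - 2) ^ 2 - 2) * lucas_V P 3 + lucas_V P 5"
proof -
  have V2: "lucas_V P 2 = P ^ 2 + 2" by (simp add: numeral_2_eq_2)
  have V4: "lucas_V P 4 = (P ^ 2 + 2) ^ 2 - 2"
    using lucas_V_add[of P 0 2] by (simp add: V2 power2_eq_square)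
  have V6: "lucas_V P 6 = lucas_V P 3 ^ 2 + 2"
    using lucas_V_add[of P 0 3] by (simp add: power2_eq_square)
  have V8: "lucas_V P 8 = ((P ^ 2 + 2) ^ 2 - 2) ^ 2 - 2"
    using lucas_V_add[of P 0 4] by (simp add: V4 power2_eq_square)
  show "lucas_V P 3 = P * (P ^ 2 + 3)"
    by (simp add: eval_nat_numeral algebra_simps)
  show "lucas_V P 5 = lucas_V P 3 * (P ^ 2 + 2) - P"
    using lucas_V_add[of P 1 2] by (simp add: V2 numeral_3_eq_3 del: lucas_V.simps(3))
  show "lucas_V P 7 = ((P ^ 2 + 2) ^ 2 - 2) * lucas_V P 3 + P"
    using lucas_V_add[of P 1 3] by (simp add: V4)
  show "lucas_V P 9 = lucas_V P 3 * (lucas_V P 3 ^ 2 + 3)"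
    using lucas_V_add[of P 3 3] by (simp add: V6 algebra_simps)
  show "lucas_V P 11 = (((P ^ 2 + 2) ^ 2 - 2) ^ 2 - 2) * lucas_V P 3 + lucas_V P 5"
    using lucas_V_add[of P 5 3] by (simp add: V8)
qed

text \<open>
  For \<open>n\<close> prime to 3 the term is odd, so it must be 5 modulo 8. For \<open>n\<close> divisible by 3 it is
  4 times an odd number, so it must be 4 modulo 16; modulo 8 nothing would be gained there.
  Periodicity reduces either condition to the indices below 12 and the residues of \<open>P\<close> modulo 16.
\<close>

lemma five_square_mod_8:
  assumes "odd P" and "odd n" and "lucas_V P n = 5 * x ^ 2"
  shows "P mod 8 \<in> {5, 7} \<longleftrightarrow> n mod 4 = 1"
proof -
  define r p where "r = n mod 12" and "p = P mod 16"
  have n: "n = r + 12 * (n div 12)" by (simp add: r_def)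
  have "odd r" "r < 12" using assms(2) by (simp_all add: r_def dvd_mod_iff)
  then have r: "r \<in> {1, 3, 5, 7, 9, 11}" unfolding insert_iff empty_iff by presburger
  have r4: "n mod 4 = r mod 4" by (simp add: r_def mod_mod_cancel)
  have "odd p" using assms(1) by (simp add: p_def dvd_mod_iff)
  moreover have "0 \<le> p" "p < 16" by (simp_all add: p_def)
  ultimately have p: "p \<in> {1, 3, 5, 7, 9, 11, 13, 15}" unfolding insert_iff empty_iff by presburger
  have p8: "P mod 8 = p mod 8" by (simp add: p_def mod_mod_cancel)
  have P: "[lucas_V P i = lucas_V p i] (mod 16)" for i
    by (rule lucas_V_cong_parameter) (simp add: p_def)
  have x: "(5 * x ^ 2) mod 8 = 5 \<or> (5 * x ^ 2) mod 16 \<in> {0, 4}"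
  proof (cases "even x")
    case True
    then obtain y where y: "x = 2 * y" by blast
    show ?thesis
    proof (cases "even y")
      case True
      then obtain z where "y = 2 * z" by blast
      then have "5 * x ^ 2 = 16 * (5 * z ^ 2)" using y by (simp add: power2_eq_square)
      then show ?thesis by simp
    next
      case False
      then obtain z where "y = 2 * z + 1" by (rule oddE)
      then have "5 * x ^ 2 = 4 + 16 * (5 * z ^ 2 + 5 * z + 1)"
        using y by (simp add: power2_eq_square algebra_simps)
      then have "(5 * x ^ 2) mod 16 = 4" by (simp only: mod_mult_self2) simp
      then show ?thesis by simp
    qed
  next
    case False
    then obtain y where "x = 2 * y + 1" by (rule oddE)
    then have eq: "5 * x ^ 2 = 20 * (y * (y + 1)) + 5"
      by (simp add: power2_eq_square algebra_simps)
    have "even (y * (y + 1))" by simp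
    then obtain t where "y * (y + 1) = 2 * t" by blast
    then have "5 * x ^ 2 = 5 + 8 * (5 * t)" using eq by simp
    then have "(5 * x ^ 2) mod 8 = 5" by (simp only: mod_mult_self2) simp
    then show ?thesis by simp
  qed
  have "[5 * x ^ 2 = lucas_V P r] (mod 8)"
    using lucas_V_mod_8[OF assms(1), of r "n div 12"] n assms(3) by metis
  moreover have "[lucas_V P r = lucas_V p r] (mod 8)"
    using P[of r] by (rule cong_dvd_modulus) simp
  ultimately have mod8: "(5 * x ^ 2) mod 8 = lucas_V p r mod 8" by (simp add: cong_def)
  have mod16: "(5 * x ^ 2) mod 16 = lucas_V p r mod 16" if "r \<in> {3, 9}"
  proof -
    have "even (lucas_V P 6)"
      using lucas_V_add[of P 0 3] four_dvd_lucas_V_3[OF assms(1)] by (auto elim!: dvdE)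
    moreover have "[lucas_V P 12 = 2] (mod 2)"
      using lucas_V_mod_8[OF assms(1), of 0 1] by (intro cong_dvd_modulus[of _ _ 8 2]) auto
    then have "even (lucas_V P 12)" by (simp add: cong_dvd_iff)
    ultimately have "even (lucas_V P (r + 3))" using that by auto
    then have "[5 * x ^ 2 = lucas_V P r] (mod 16)"
      using lucas_V_mod_16[OF assms(1), of r "n div 12"] n assms(3) by metis
    with P[of r] show ?thesis by (simp add: cong_def)
  qed
  from x have "(5 * x ^ 2) mod 8 \<in> {0, 4, 5}"
    using mod_mod_cancel[of 8 16 "5 * x ^ 2"] by auto
  then have "lucas_V p r mod 8 \<in> {0, 4, 5}" unfolding mod8 .
  moreover have "lucas_V p r mod 8 = 5 \<or> lucas_V p r mod 16 \<in> {0, 4}" if "r \<in> {3, 9}"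
    using x unfolding mod8 mod16[OF that] .
  ultimately show ?thesis using r p unfolding r4 p8
    by (elim insertE emptyE; simp add: lucas_V_odd_index)
qed

section \<open>The terms that are five times a square\<close>

theorem theorem3p3:
  fixes P x :: int and n :: nat
  assumes "P > 0" and "odd P" and "n \<ge> 1" and "lucas_V P n = 5 * x ^ 2"
  shows "n = 1"
proof (rule ccontr)
  assume "n \<noteq> 1"
  then have "n > 1" using assms(3) by simp
  have V: "5 dvd lucas_V P n" using assms(4) by simp
  then have P: "5 dvd P" by (rule five_dvd_lucas_V_imp)
  then have "odd n" using V by (rule odd_index_if_five_dvd)
  note mod8 = five_square_mod_8[OF assms(2) this assms(4)]
  from odd_mod_4[OF \<open>odd n\<close>] show False
  proof
    assume "n mod 4 = 1"
    then show False
      using five_square_1_mod_4[OF assms(1,2) P assms(4) _ \<open>n > 1\<close>] mod8 by blast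
  next
    assume "n mod 4 = 3"
    then show False
      using five_square_3_mod_4[OF assms(1,2) P assms(4)] mod8 by simp
  qed
qed

end
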